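(* Let $\mathcal{P}$ be a polytope in $\mathbb{R}^n$ with exactly $N+1$ faces of dimension $n-1$. Then the Hilbert geometry of (the interior of) $\mathcal{P}$ can be isometrically embedded in a normed vector space of dimension $N$; that is, there exist a norm $\|\cdot\|_*$ on $\mathbb{R}^N$ and a map $f\colon \operatorname{int}(\mathcal{P})\to\mathbb{R}^N$ such that $\|f(x)-f(y)\|_* = d_{\mathcal{P}}(x,y)$ for all $x,y\in\operatorname{int}(\mathcal{P})$, where $d_{\mathcal{P}}$ denotes the Hilbert distance of the bounded open convex set $\operatorname{int}(\mathcal{P})$.
   Context: A polytope in $\mathbb{R}^n$ is the convex hull of a finite number of points such that $n+1$ of them are affinely independent; in particular it has non-empty interior. Faces: for a closed convex set $K$, two points $A,B\in K$ are equivalent if there exists a segment $[C,D]\subset K$ containing the segment $[A,B]$ with $C\neq A,B$ and $D\neq A,B$. The equivalence classes are called faces, and a face is a $k$-face if the affine space it generates has dimension $k$. The $(n-1)$-faces of a polytope in $\mathbb{R}^n$ are thus its (relatively open) facets. Hilbert distance: let $\mathcal{C}\subset\mathbb{R}^n$ be a non-empty bounded open convex set. For distinct points $p,q\in\mathcal{C}$, the line through $p$ and $q$ meets the boundary $\partial\mathcal{C}$ at two points $a$ and $b$, named so that $a,p,q,b$ occur in this order on the line. The Hilbert distance is $$d_{\mathcal{C}}(p,q)=\frac12\log\left(\frac{\|q-a\|}{\|p-a\|}\cdot\frac{\|p-b\|}{\|q-b\|}\right),$$ where $\|\cdot\|$ is the standard Euclidean norm, and $d_{\mathcal{C}}(p,p)=0$.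 *)

theory Defs
  imports "HOL-Analysis.Analysis"
begin

(* Unlike the library predicate polytope, this one forces full dimension. *)
definition full_polytope :: "(real ^ 'n) set \<Rightarrow> bool"
  where "full_polytope P \<longleftrightarrow>
    (\<exists>V. finite V \<and> P = convex hull V \<and>
      (\<exists>W \<subseteq> V. card W = CARD('n) + 1 \<and> \<not> affine_dependent W))"

(* The disjunct A = B is needed for reflexivity: an extreme point of K lies strictly inside no
   segment of K, but forms a 0-dimensional face by itself. *)
definition face_rel :: "'a::euclidean_space set \<Rightarrow> ('a \<times> 'a) set"
  where "face_rel K = {(A, B). A \<in> K \<and> B \<in> K \<and>
    (A = B \<or> (\<exists>C D. closed_segment C D \<subseteq> K \<and> closed_segment A B \<subseteq> closed_segment C D \<and>
      C \<noteq> A \<and> C \<noteq> B \<and> D \<noteq> A \<and> D \<noteq> B))}"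

(* These faces are relatively open and partition K; the face_of relation of the library
   describes their closures instead. *)
definition k_faces :: "nat \<Rightarrow> 'a::euclidean_space set \<Rightarrow> 'a set set"
  where "k_faces k K = {F \<in> K // face_rel K. aff_dim F = int k}"

(* For p \<noteq> q the two open-segment conditions say that a, p, q, b are distinct and lie in
   this order on the line through p and q. *)
definition chord_ends :: "'a::euclidean_space set \<Rightarrow> 'a \<Rightarrow> 'a \<Rightarrow> 'a \<times> 'a"
  where "chord_ends C p q = (THE (a, b). a \<in> frontier C \<and> b \<in> frontier C \<and>
    p \<in> open_segment a q \<and> q \<in> open_segment p b)"

(* Meaningful for p, q in a non-empty bounded open convex set C. *)
definition hilbert_dist :: "'a::euclidean_space set \<Rightarrow> 'a \<Rightarrow> 'a \<Rightarrow> real"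
  where "hilbert_dist C p q = (if p = q then 0 else
    (case chord_ends C p q of (a, b) \<Rightarrow>
      1/2 * ln (norm (q - a) / norm (p - a) * (norm (p - b) / norm (q - b)))))"

definition is_norm :: "('a::real_vector \<Rightarrow> real) \<Rightarrow> bool"
  where "is_norm \<nu> \<longleftrightarrow>
    (\<forall>x. 0 \<le> \<nu> x) \<and> (\<forall>x. \<nu> x = 0 \<longleftrightarrow> x = 0) \<and>
    (\<forall>c x. \<nu> (c *\<^sub>R x) = \<bar>c\<bar> * \<nu> x) \<and>
    (\<forall>x y. \<nu> (x + y) \<le> \<nu> x + \<nu> y)"

end

theory Submission
  imports Defs
begin

text \<open>
  Let \<open>h F\<close>, for a facet \<open>F\<close> of the polytope \<open>P\<close>, be an affine function that vanishes on \<open>F\<close> and is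
  positive in the interior. On the ray from \<open>y\<close> through \<open>x\<close>, the function \<open>h F\<close> decreases to zero
  only if \<open>h F x < h F y\<close>, and the ray leaves \<open>P\<close> through the facet whose functional vanishes
  first. If it does so at \<open>a = y + s (x - y)\<close>, then
  \<open>\<parallel>y - a\<parallel> / \<parallel>x - a\<parallel> = s / (s - 1)\<close>, and non-negativity of all \<open>h F a\<close>, with equality for one
  facet, says exactly that this ratio is the maximum of \<open>h F y / h F x\<close> over the facets
  (\<open>exit_parameter_facet_ratio\<close>). The same holds at the other end of the chord with \<open>x\<close> and \<open>y\<close>
  exchanged. Taking logarithms,
  \<open>d(x, y) = 1/2 (max u - min u)\<close> where \<open>u F = ln (h F x) - ln (h F y)\<close>
  (\<open>hilbert_dist_polytope\<close>).

  So the map sending \<open>x\<close> to the family of all \<open>ln (h F x)\<close> is isometric for half the variation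
  \<open>max - min\<close>, a seminorm on the functions of \<open>N + 1\<close> facets whose kernel is the line of constant
  functions. The quotient by this line has dimension \<open>N\<close> and the seminorm becomes a norm there;
  concretely, one facet is chosen as base point and its coordinate is subtracted from all others
  (\<open>is_norm_variation_extend0\<close>, \<open>variation_shift\<close>).

  It remains to see that the equivalence classes that define the \<open>(n-1)\<close>-faces are in bijection
  with the facets in the sense of \<open>facet_of\<close>, namely as their relative interiors
  (\<open>face_rel_Image_rel_interior\<close>, \<open>card_facets_full_polytope\<close>).
\<close>

section \<open>Relatively open faces and facets\<close>

text \<open>A face of least dimension containing \<open>x\<close> works: were \<open>x\<close> on the relative boundary of that
  face, it would lie in one of its facets, which is again a face of \<open>K\<close>.\<close>

lemma polyhedron_point_in_rel_interior_face:
  fixes K :: "'a::euclidean_space set"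
  assumes K: "polyhedron K" and x: "x \<in> K"
  obtains F where "F face_of K" "x \<in> rel_interior F"
proof -
  \<comment> \<open>The shift by one makes the dimension a natural number even for the empty face.\<close>
  define F where "F = arg_min (\<lambda>F. nat (aff_dim F + 1)) (\<lambda>F. F face_of K \<and> x \<in> F)"
  have K0: "K face_of K \<and> x \<in> K"
    using x face_of_refl[OF polyhedron_imp_convex[OF K]] by blast
  have F: "F face_of K" "x \<in> F"
    using arg_min_natI[of "\<lambda>F. F face_of K \<and> x \<in> F", OF K0] unfolding F_def by auto
  have le: "nat (aff_dim F + 1) \<le> nat (aff_dim G + 1)" if "G face_of K" "x \<in> G" for G
    unfolding F_def by (rule arg_min_nat_le) (use that in auto)
  have "x \<in> rel_interior F"
  proof (rule ccontr)
    assume "x \<notin> rel_interior F"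
    moreover have "polyhedron F"
      using F(1) K face_of_polyhedron_polyhedron by blast
    ultimately obtain G where G: "G facet_of F" "x \<in> G"
      using rel_boundary_of_polyhedron[of F] F(2) by blast
    have "G face_of K"
      using G(1) F(1) facet_of_imp_face_of face_of_trans by blast
    with le[of G] G have "nat (aff_dim F + 1) \<le> nat (aff_dim G + 1)" by blast
    moreover have "aff_dim G = aff_dim F - 1"
      using G(1) by (simp add: facet_of_def)
    moreover have "aff_dim G \<ge> -1"
      by (rule aff_dim_geq)
    ultimately show False by linarith
  qed
  with F(1) show thesis using that by blast
qed

lemma rel_interior_extend_segment:
  fixes F :: "'a::euclidean_space set"
  assumes "convex F" "x \<in> rel_interior F" "y \<in> F" "x \<noteq> y"
  obtains D where "D \<in> F" "x \<in> open_segment y D"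
proof -
  obtain e where e: "e > 1" "(1 - e) *\<^sub>R y + e *\<^sub>R x \<in> F"
    using convex_rel_interior_iff[of F x] assms by blast
  define D where "D = (1 - e) *\<^sub>R y + e *\<^sub>R x"
  have D: "D = y + e *\<^sub>R (x - y)"
    by (simp add: D_def algebra_simps)
  have "x = (1 - 1/e) *\<^sub>R y + (1/e) *\<^sub>R D"
    using e(1) by (simp add: D algebra_simps)
  moreover have "D \<noteq> y"
    using e(1) assms(4) by (simp add: D)
  ultimately have "x \<in> open_segment y D"
    unfolding in_segment using e(1) by (auto intro!: exI[of _ "1/e"])
  with e(2) show thesis using that D_def by blast
qed

text \<open>Two points of the relative interior of a face span a segment that can be prolonged within the
  face beyond both ends. Conversely, if \<open>x\<close> and \<open>y\<close> are inner points of one segment in \<open>K\<close>, every face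
  containing one of them contains the ends of the segment and hence the other point, so that the
  smallest faces around \<open>x\<close> and \<open>y\<close> contain each other.\<close>

lemma face_rel_Image_rel_interior:
  fixes K :: "'a::euclidean_space set"
  assumes K: "polyhedron K" and F: "F face_of K" and x: "x \<in> rel_interior F"
  shows "face_rel K `` {x} = rel_interior F"
proof
  have cF: "convex F" and FK: "F \<subseteq> K"
    using F face_of_imp_convex face_of_imp_subset by blast+
  have rF: "rel_interior F \<subseteq> F"
    by (rule rel_interior_subset)
  show "rel_interior F \<subseteq> face_rel K `` {x}"
  proof
    fix y assume y: "y \<in> rel_interior F"
    show "y \<in> face_rel K `` {x}"
    proof (cases "x = y")
      case True
      then show ?thesis using x rF FK by (auto simp: face_rel_def)
    next
      case False
      obtain C where C: "C \<in> F" "x \<in> open_segment y C"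
        using rel_interior_extend_segment[OF cF x, of y] y rF False by blast
      \<comment> \<open>The second prolongation starts from \<open>C\<close> instead of \<open>x\<close>, so that \<open>y\<close> is
        immediately an inner point of the whole segment.\<close>
      obtain D where D: "D \<in> F" "y \<in> open_segment C D"
      proof (rule rel_interior_extend_segment[OF cF y C(1)])
        show "y \<noteq> C" using C(2) by auto
      qed blast
      have xCy: "x \<in> open_segment C y"
        using C(2) by (simp add: open_segment_commute)
      then have "x \<in> closed_segment C D"
        using D(2) by (meson convex_closed_segment convex_contains_segment ends_in_segment(1)
            open_closed_segment subsetD)
      moreover have "x \<noteq> D"
        using xCy D(2) by (metis False between_antisym between_mem_segment open_closed_segment
            open_segment_commute)
      moreover have "closed_segment C D \<subseteq> K"
        using C(1) D(1) cF FK by (meson closed_segment_subset order_trans)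
      moreover have "closed_segment x y \<subseteq> closed_segment C D"
        using calculation(1) D(2) by (simp add: closed_segment_subset open_closed_segment)
      moreover have "C \<noteq> x" "C \<noteq> y" "D \<noteq> y"
        using xCy D(2) by (auto simp: open_segment_def)
      ultimately show ?thesis
        using x y rF FK unfolding face_rel_def by blast
    qed
  qed
  show "face_rel K `` {x} \<subseteq> rel_interior F"
  proof
    fix y assume "y \<in> face_rel K `` {x}"
    then have xy: "(x, y) \<in> face_rel K" by simp
    show "y \<in> rel_interior F"
    proof (cases "x = y")
      case True
      with x show ?thesis by simp
    next
      case False
      with xy obtain C D where yK: "y \<in> K" and CD: "closed_segment C D \<subseteq> K"
        "closed_segment x y \<subseteq> closed_segment C D"
        "C \<noteq> x" "C \<noteq> y" "D \<noteq> x" "D \<noteq> y"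
        unfolding face_rel_def by blast
      have xo: "x \<in> open_segment C D" and yo: "y \<in> open_segment C D"
        using CD by (auto simp: open_segment_def)
      have CK: "C \<in> K" and DK: "D \<in> K"
        using CD(1) by auto
      have "C \<in> F" "D \<in> F"
        using F CK DK xo x rF unfolding face_of_def by blast+
      then have yF: "y \<in> F"
        using cF yo by (meson closed_segment_subset open_closed_segment subsetD)
      obtain G where G: "G face_of K" "y \<in> rel_interior G"
        using polyhedron_point_in_rel_interior_face[OF K yK] .
      have "y \<in> G" using G(2) rel_interior_subset by blast
      then have "C \<in> G" "D \<in> G"
        using G(1) CK DK yo unfolding face_of_def by blast+
      then have "x \<in> G"
        using face_of_imp_convex[OF G(1)] xo
        by (meson closed_segment_subset open_closed_segment subsetD)
      then have "F \<subseteq> G"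
        using subset_of_face_of[OF G(1) FK] x by blast
      moreover have "G \<subseteq> F"
        using subset_of_face_of[OF F face_of_imp_subset[OF G(1)]] G(2) yF by blast
      ultimately show ?thesis using G(2) by simp
    qed
  qed
qed

lemma k_faces_polyhedron:
  fixes K :: "'a::euclidean_space set"
  assumes K: "polyhedron K"
  shows "k_faces k K = rel_interior ` {F. F face_of K \<and> aff_dim F = int k}"
proof
  show "k_faces k K \<subseteq> rel_interior ` {F. F face_of K \<and> aff_dim F = int k}"
  proof
    fix A assume "A \<in> k_faces k K"
    then obtain x where x: "x \<in> K" "A = face_rel K `` {x}" "aff_dim A = int k"
      unfolding k_faces_def quotient_def by blast
    obtain F where F: "F face_of K" "x \<in> rel_interior F"
      using polyhedron_point_in_rel_interior_face[OF K x(1)] .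
    have A: "A = rel_interior F"
      using face_rel_Image_rel_interior[OF K F] x(2) by simp
    then have "aff_dim F = int k"
      using x(3) rel_interior_aff_dim[OF face_of_imp_convex[OF F(1)]] by simp
    then show "A \<in> rel_interior ` {F. F face_of K \<and> aff_dim F = int k}"
      using A F(1) by blast
  qed
  show "rel_interior ` {F. F face_of K \<and> aff_dim F = int k} \<subseteq> k_faces k K"
  proof
    fix A assume "A \<in> rel_interior ` {F. F face_of K \<and> aff_dim F = int k}"
    then obtain F where F: "F face_of K" "aff_dim F = int k" "A = rel_interior F"
      by blast
    have cF: "convex F" using F(1) face_of_imp_convex by blast
    have "F \<noteq> {}" using F(2) by auto
    then obtain x where x: "x \<in> rel_interior F"
      using rel_interior_eq_empty[OF cF] by blast
    then have "x \<in> K"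
      using F(1) face_of_imp_subset rel_interior_subset by blast
    moreover have "A = face_rel K `` {x}"
      using face_rel_Image_rel_interior[OF K F(1) x] F(3) by simp
    moreover have "aff_dim A = int k"
      using F rel_interior_aff_dim[OF cF] by simp
    ultimately show "A \<in> k_faces k K"
      unfolding k_faces_def quotient_def by blast
  qed
qed

text \<open>No two faces share their relative interior, because the closure recovers a face from it.\<close>

lemma card_k_faces_polyhedron:
  fixes K :: "'a::euclidean_space set"
  assumes K: "polyhedron K"
  shows "card (k_faces k K) = card {F. F face_of K \<and> aff_dim F = int k}"
proof -
  have "closure (rel_interior F) = F" if "F face_of K" for F
    using that K convex_closure_rel_interior face_of_imp_closed face_of_imp_convex
      polyhedron_imp_closed polyhedron_imp_convex closure_closed by metis
  then have "inj_on rel_interior {F. F face_of K \<and> aff_dim F = int k}"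
    by (intro inj_on_inverseI[where g = closure]) auto
  then show ?thesis
    by (simp add: k_faces_polyhedron[OF K] card_image)
qed

lemma full_polytope_affine_hull:
  fixes P :: "(real ^ 'n) set"
  assumes "full_polytope P"
  shows "polytope P" "affine hull P = UNIV"
proof -
  obtain V W where V: "finite V" "P = convex hull V" "W \<subseteq> V"
    "card W = CARD('n) + 1" "\<not> affine_dependent W"
    using assms unfolding full_polytope_def by blast
  show "polytope P" using V unfolding polytope_def by blast
  have "aff_dim W = int CARD('n)"
    using aff_dim_affine_independent[OF V(5)] V(4) by simp
  moreover have "aff_dim W \<le> aff_dim P"
    using V by (meson aff_dim_subset hull_subset order_trans)
  moreover have "aff_dim P \<le> int CARD('n)"
    using aff_dim_le_DIM[of P] by simp
  ultimately have "aff_dim P = int DIM(real ^ 'n)" by simp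
  then show "affine hull P = UNIV"
    using aff_dim_eq_full by blast
qed

lemma card_facets_full_polytope:
  fixes P :: "(real ^ 'n) set"
  assumes "full_polytope P"
  shows "card (k_faces (CARD('n) - 1) P) = card {F. F facet_of P}"
proof -
  have "aff_dim P = int CARD('n)"
    using full_polytope_affine_hull(2)[OF assms] aff_dim_eq_full[of P] by simp
  moreover have "CARD('n) > 0" by simp
  ultimately have "F facet_of P \<longleftrightarrow> F face_of P \<and> aff_dim F = int (CARD('n) - 1)" for F
    unfolding facet_of_def by (auto simp: of_nat_diff Suc_le_eq)
  then have "{F. F facet_of P} = {F. F face_of P \<and> aff_dim F = int (CARD('n) - 1)}"
    by blast
  then show ?thesis
    using card_k_faces_polyhedron[OF polytope_imp_polyhedron, OF full_polytope_affine_hull(1)[OF assms]]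
    by metis
qed

section \<open>The Hilbert distance in terms of facet functionals\<close>

text \<open>All points of a ray before a boundary point are interior; this makes the chord ends unique.\<close>

lemma ray_frontier_unique:
  fixes y v :: "'a::euclidean_space"
  assumes C: "convex C" "open C" and y: "y \<in> C"
    and s: "s > 0" "y + s *\<^sub>R v \<in> frontier C"
    and t: "t > 0" "y + t *\<^sub>R v \<in> frontier C"
  shows "s = t"
proof -
  have False if "0 < p" "p < q" "y + p *\<^sub>R v \<in> frontier C" "y + q *\<^sub>R v \<in> frontier C" for p q
  proof -
    have "v \<noteq> 0"
      using that(3) y C(2) by (auto simp: frontier_def interior_open)
    have "y + p *\<^sub>R v = (1 - p/q) *\<^sub>R y + (p/q) *\<^sub>R (y + q *\<^sub>R v)"
      using that(1,2) by (simp add: algebra_simps)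
    then have "y + p *\<^sub>R v \<in> open_segment y (y + q *\<^sub>R v)"
      unfolding in_segment using that(1,2) \<open>v \<noteq> 0\<close>
      by (auto intro!: exI[of _ "p/q"])
    moreover have "y + q *\<^sub>R v \<in> closure C"
      using that(4) by (simp add: frontier_def)
    ultimately show False
      using in_interior_closure_convex_segment[OF C(1), of y "y + q *\<^sub>R v"] y that(3) C(2)
      by (auto simp: frontier_def interior_open)
  qed
  then show ?thesis
    using s t by (meson linorder_neqE_linordered_idom)
qed

lemma mem_open_segment_ray_iff:
  fixes a x y :: "'a::real_vector"
  assumes "x \<noteq> y"
  shows "x \<in> open_segment a y \<longleftrightarrow> (\<exists>s>1. a = y + s *\<^sub>R (x - y))"
proof
  assume "x \<in> open_segment a y"
  then obtain u where u: "0 < u" "u < 1" "x = (1 - u) *\<^sub>R a + u *\<^sub>R y"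
    unfolding in_segment by blast
  have d: "x - y = (1 - u) *\<^sub>R (a - y)"
    using u(3) by (simp add: algebra_simps)
  have "a = y + (1/(1-u)) *\<^sub>R (x - y)"
    unfolding d scaleR_scaleR using u(2) by simp
  moreover have "1/(1-u) > 1" using u by simp
  ultimately show "\<exists>s>1. a = y + s *\<^sub>R (x - y)" by blast
next
  assume "\<exists>s>1. a = y + s *\<^sub>R (x - y)"
  then obtain s where s: "s > 1" "a = y + s *\<^sub>R (x - y)" by blast
  have "x = (1 - (1 - 1/s)) *\<^sub>R a + (1 - 1/s) *\<^sub>R y"
    using s(1) by (simp add: s(2) algebra_simps)
  moreover have "a \<noteq> y" using s assms by simp
  ultimately show "x \<in> open_segment a y"
    unfolding in_segment using s(1) by (auto intro!: exI[of _ "1 - 1/s"])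
qed

text \<open>Both logarithms depend only on the position parameters of the chord ends, as the norm of
  \<open>x - y\<close> cancels in each of the two ratios.\<close>

lemma hilbert_dist_ray_parameters:
  fixes x y :: "'a::euclidean_space"
  assumes C: "convex C" "open C" and x: "x \<in> C" and y: "y \<in> C" and xy: "x \<noteq> y"
    and s: "s > 1" "y + s *\<^sub>R (x - y) \<in> frontier C"
    and t: "t > 1" "x + t *\<^sub>R (y - x) \<in> frontier C"
  shows "hilbert_dist C x y = 1/2 * (ln (s / (s - 1)) + ln (t / (t - 1)))"
proof -
  define a where "a = y + s *\<^sub>R (x - y)"
  define b where "b = x + t *\<^sub>R (y - x)"
  have ab: "x \<in> open_segment a y" "y \<in> open_segment x b"
    using mem_open_segment_ray_iff[OF xy, of a] mem_open_segment_ray_iff[OF xy[symmetric], of b]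
      s(1) t(1) open_segment_commute[of x b]
    unfolding a_def b_def by blast+
  have "chord_ends C x y = (a, b)"
    unfolding chord_ends_def
  proof (rule the_equality)
    show "case (a, b) of (a, b) \<Rightarrow> a \<in> frontier C \<and> b \<in> frontier C \<and>
        x \<in> open_segment a y \<and> y \<in> open_segment x b"
      using ab s(2) t(2) by (simp add: a_def b_def)
  next
    fix c :: "'a \<times> 'a"
    assume "case c of (a, b) \<Rightarrow> a \<in> frontier C \<and> b \<in> frontier C \<and>
        x \<in> open_segment a y \<and> y \<in> open_segment x b"
    then obtain a' b' where c: "c = (a', b')" "a' \<in> frontier C" "b' \<in> frontier C"
        "x \<in> open_segment a' y" "y \<in> open_segment x b'"
      by (cases c) auto
    obtain s' where s': "s' > 1" "a' = y + s' *\<^sub>R (x - y)"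
      using c(4) mem_open_segment_ray_iff[OF xy] by blast
    obtain t' where t': "t' > 1" "b' = x + t' *\<^sub>R (y - x)"
      using c(5) mem_open_segment_ray_iff[OF xy[symmetric]] open_segment_commute by blast
    have "s' = s"
      using ray_frontier_unique[OF C y, of s' "x - y" s] s s' c(2) by simp
    moreover have "t' = t"
      using ray_frontier_unique[OF C x, of t' "y - x" t] t t' c(3) by simp
    ultimately show "c = (a, b)"
      using c(1) s'(2) t'(2) by (simp add: a_def b_def)
  qed
  moreover have "norm (y - a) = s * norm (x - y)"
    using s(1) by (simp add: a_def)
  moreover have "x - a = (1 - s) *\<^sub>R (x - y)"
    by (simp add: a_def algebra_simps)
  then have "norm (x - a) = (s - 1) * norm (x - y)"
    using s(1) by simp
  moreover have "norm (x - b) = t * norm (x - y)"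
    using t(1) by (simp add: b_def norm_minus_commute)
  moreover have "y - b = (t - 1) *\<^sub>R (x - y)"
    by (simp add: b_def algebra_simps)
  then have "norm (y - b) = (t - 1) * norm (x - y)"
    using t(1) by simp
  ultimately have "hilbert_dist C x y = 1/2 * ln (s / (s - 1) * (t / (t - 1)))"
    using xy by (simp add: hilbert_dist_def)
  then show ?thesis
    using s(1) t(1) ln_mult[of "s / (s - 1)" "t / (t - 1)"] by simp
qed

text \<open>Only these three properties of the facet functionals enter the argument: they are affine along
  lines, non-negative on \<open>P\<close>, and vanish in \<open>P\<close> precisely on their facet.\<close>

lemma polyhedron_facet_functionals:
  fixes P :: "'a::euclidean_space set"
  assumes P: "polyhedron P"
  obtains h :: "'a set \<Rightarrow> 'a \<Rightarrow> real" where
    "\<And>F x y u. h F (y + u *\<^sub>R (x - y)) = h F y + u * (h F x - h F y)"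
    "\<And>F x. F facet_of P \<Longrightarrow> x \<in> P \<Longrightarrow> 0 \<le> h F x"
    "\<And>F x. F facet_of P \<Longrightarrow> x \<in> P \<Longrightarrow> h F x = 0 \<longleftrightarrow> x \<in> F"
proof -
  have "\<exists>a b. F facet_of P \<longrightarrow> P \<subseteq> {x. a \<bullet> x \<le> b} \<and> F = P \<inter> {x. a \<bullet> x = b}" for F
    using facet_of_polyhedron[OF P, of F] by metis
  then obtain a b where ab:
    "\<And>F. F facet_of P \<Longrightarrow> P \<subseteq> {x. a F \<bullet> x \<le> b F} \<and> F = P \<inter> {x. a F \<bullet> x = b F}"
    by metis
  show thesis
  proof (rule that[of "\<lambda>F x. b F - a F \<bullet> x"])
    show "b F - a F \<bullet> (y + u *\<^sub>R (x - y))
      = b F - a F \<bullet> y + u * (b F - a F \<bullet> x - (b F - a F \<bullet> y))" for F x y u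
      by (simp add: inner_add_right inner_diff_right algebra_simps)
    show "0 \<le> b F - a F \<bullet> x" if "F facet_of P" "x \<in> P" for F x
      using ab[OF that(1)] that(2) by auto
    show "b F - a F \<bullet> x = 0 \<longleftrightarrow> x \<in> F" if "F facet_of P" "x \<in> P" for F x
    proof -
      have "x \<in> F \<longleftrightarrow> x \<in> P \<inter> {x. a F \<bullet> x = b F}"
        using ab[OF that(1)] by blast
      with that(2) show ?thesis by auto
    qed
  qed
qed

lemma interior_not_in_facet:
  fixes P :: "'a::euclidean_space set"
  assumes "F facet_of P" "x \<in> interior P"
  shows "x \<notin> F"
proof -
  have "F \<noteq> P" using assms(1) by (auto simp: facet_of_def)
  then show ?thesis
    using face_of_disjoint_interior assms facet_of_imp_face_of by blast
qed

text \<open>At the exit point, \<open>h F\<close> takes the value \<open>s * h F x - (s - 1) * h F y\<close>. Its sign compares the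
  two ratios in the statement, and it is zero for a facet that contains the exit point.\<close>

lemma exit_parameter_facet_ratio:
  fixes P :: "'a::euclidean_space set"
  assumes P: "polytope P" "affine hull P = UNIV"
    and h: "\<And>F x y u. h F (y + u *\<^sub>R (x - y)) = h F y + u * (h F x - h F y)"
      "\<And>F x. F facet_of P \<Longrightarrow> x \<in> P \<Longrightarrow> 0 \<le> (h F x :: real)"
      "\<And>F x. F facet_of P \<Longrightarrow> x \<in> P \<Longrightarrow> h F x = 0 \<longleftrightarrow> x \<in> F"
    and x: "x \<in> interior P" and y: "y \<in> interior P" and xy: "x \<noteq> y"
  obtains s where "s > 1" "y + s *\<^sub>R (x - y) \<in> frontier (interior P)"
    "\<And>F. F facet_of P \<Longrightarrow> h F y / h F x \<le> s / (s - 1)"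
    "\<exists>F. F facet_of P \<and> h F y / h F x = s / (s - 1)"
proof -
  have ph: "polyhedron P" and cv: "convex P" and cl: "closed P" and bd: "bounded P"
    using P(1) by (simp_all add: polytope_imp_polyhedron polytope_imp_convex polytope_imp_closed
        polytope_imp_bounded)
  have fr: "frontier (interior P) = frontier P"
    using convex_closure_interior[OF cv] x by (auto simp: frontier_def)
  obtain d where d: "d > 0" "x + d *\<^sub>R (x - y) \<in> frontier P"
    using ray_to_frontier[OF bd x, of "x - y"] xy by auto
  define s where "s = 1 + d"
  define a where "a = y + s *\<^sub>R (x - y)"
  have s: "s > 1" using d by (simp add: s_def)
  have "a = x + d *\<^sub>R (x - y)" by (simp add: a_def s_def algebra_simps)
  then have a: "a \<in> frontier P" using d by simp
  then have aP: "a \<in> P" using cl frontier_subset_closed by blast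
  have pos: "h F x > 0" if "F facet_of P" for F
    using h(2,3)[OF that, of x] interior_not_in_facet[OF that x] x interior_subset by fastforce
  have eq: "h F a = (s - 1) * h F x * (s / (s - 1) - h F y / h F x)" if "F facet_of P" for F
  proof -
    have "h F a = h F y + s * (h F x - h F y)"
      unfolding a_def by (rule h(1))
    also have "\<dots> = s * h F x - (s - 1) * h F y"
      by (simp add: algebra_simps)
    also have "\<dots> = (s - 1) * h F x * (s / (s - 1) - h F y / h F x)"
      unfolding right_diff_distrib using s pos[OF that] by simp
    finally show ?thesis .
  qed
  have *: "(s - 1) * h F x > 0" if "F facet_of P" for F
    using s pos[OF that] by simp
  show thesis
  proof (rule that[OF s])
    show "y + s *\<^sub>R (x - y) \<in> frontier (interior P)"
      using a fr by (simp add: a_def)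
    show "h F y / h F x \<le> s / (s - 1)" if "F facet_of P" for F
    proof -
      have "0 \<le> (s - 1) * h F x * (s / (s - 1) - h F y / h F x)"
        using eq[OF that] h(2)[OF that aP] by simp
      then show ?thesis
        using *[OF that] by (simp add: zero_le_mult_iff)
    qed
    have "rel_frontier P = frontier P"
      using rel_frontier_frontier[OF P(2)] .
    then obtain F where F: "F facet_of P" "a \<in> F"
      using a rel_frontier_of_polyhedron[OF ph] by blast
    have "(s - 1) * h F x * (s / (s - 1) - h F y / h F x) = 0"
      using eq[OF F(1)] h(3)[OF F(1) aP] F(2) by simp
    then have "h F y / h F x = s / (s - 1)"
      using *[OF F(1)] by (metis eq_iff_diff_eq_0 less_irrefl mult_eq_0_iff)
    then show "\<exists>F. F facet_of P \<and> h F y / h F x = s / (s - 1)"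
      using F(1) by blast
  qed
qed

section \<open>The variation norm\<close>

text \<open>Vectors stand for functions on \<open>'m option\<close> modulo constants, through the representative that
  vanishes at \<open>None\<close>.\<close>

definition extend0 :: "real ^ 'm \<Rightarrow> 'm option \<Rightarrow> real"
  where "extend0 v p = (case p of None \<Rightarrow> 0 | Some i \<Rightarrow> v $ i)"

text \<open>Taking the maximum over pairs, instead of \<open>max - min\<close>, makes invariance under constants and
  the triangle inequality immediate.\<close>

definition variation :: "('p::finite \<Rightarrow> real) \<Rightarrow> real"
  where "variation w = Max (range (\<lambda>(p, q). w p - w q))"

lemma variation_ge: "w p - w q \<le> variation w"
  unfolding variation_def by (rule Max_ge) (auto intro!: image_eqI[of _ _ "(p, q)"])

lemma variation_attained: obtains p q where "variation w = w p - w q"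
proof -
  have "variation w \<in> range (\<lambda>(p, q). w p - w q)"
    unfolding variation_def by (rule Max_in) auto
  then show thesis using that by auto
qed

lemma variation_eqI:
  assumes "\<And>p. w p \<le> A" "w p0 = A" "\<And>p. - w p \<le> B" "- w q0 = B"
  shows "variation w = A + B"
proof (rule antisym)
  obtain p q where "variation w = w p - w q" by (rule variation_attained)
  with assms(1)[of p] assms(3)[of q] show "variation w \<le> A + B" by linarith
  show "A + B \<le> variation w"
    using variation_ge[of w p0 q0] assms(2,4) by linarith
qed

lemma variation_shift: "variation (\<lambda>p. w p - c) = variation w"
  by (simp add: variation_def)

lemma extend0_simps [simp]:
  "extend0 v None = 0" "extend0 v (Some i) = v $ i"
  by (simp_all add: extend0_def)

lemma extend0_linear:
  "extend0 (c *\<^sub>R v) p = c * extend0 v p" "extend0 (v + w) p = extend0 v p + extend0 w p"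
  by (simp_all add: extend0_def split: option.split)

text \<open>Definiteness is the point where the base coordinate matters: a function of variation zero is
  constant, and its value is the value zero at \<open>None\<close>.\<close>

lemma is_norm_variation_extend0:
  "is_norm (\<lambda>v :: real ^ 'm. 1/2 * variation (extend0 v))"
proof -
  have nonneg: "0 \<le> variation (extend0 v)" for v :: "real ^ 'm"
    using variation_ge[of "extend0 v" None None] by simp
  have zero: "variation (extend0 v) = 0 \<longleftrightarrow> v = 0" for v :: "real ^ 'm"
  proof
    assume v: "variation (extend0 v) = 0"
    have "v $ i = 0" for i
      using variation_ge[of "extend0 v" "Some i" None] variation_ge[of "extend0 v" None "Some i"] v
      by simp
    then show "v = 0" by (simp add: vec_eq_iff)
  next
    assume "v = 0"
    then have "extend0 v p = 0" for p
      by (simp add: extend0_def split: option.split)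
    then show "variation (extend0 v) = 0"
      by (metis variation_attained diff_self)
  qed
  have le: "variation (extend0 (c *\<^sub>R v)) \<le> \<bar>c\<bar> * variation (extend0 v)" for c and v :: "real ^ 'm"
  proof -
    obtain p q where pq: "variation (extend0 (c *\<^sub>R v)) = extend0 (c *\<^sub>R v) p - extend0 (c *\<^sub>R v) q"
      by (rule variation_attained)
    also have "\<dots> = c * (extend0 v p - extend0 v q)"
      by (simp add: extend0_linear algebra_simps)
    also have "\<dots> \<le> \<bar>c\<bar> * \<bar>extend0 v p - extend0 v q\<bar>"
      by (metis abs_ge_self abs_mult)
    also have "\<dots> \<le> \<bar>c\<bar> * variation (extend0 v)"
      using variation_ge[of "extend0 v" p q] variation_ge[of "extend0 v" q p]
      by (intro mult_left_mono) auto
    finally show ?thesis .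
  qed
  \<comment> \<open>The reverse inequality is the previous one for the scalar \<open>1/c\<close>.\<close>
  have hom: "variation (extend0 (c *\<^sub>R v)) = \<bar>c\<bar> * variation (extend0 v)" for c and v :: "real ^ 'm"
  proof (cases "c = 0")
    case True
    then show ?thesis using zero[of 0] by simp
  next
    case False
    have "variation (extend0 v) \<le> \<bar>1/c\<bar> * variation (extend0 (c *\<^sub>R v))"
      using le[of "1/c" "c *\<^sub>R v"] False by simp
    then have "\<bar>c\<bar> * variation (extend0 v) \<le> variation (extend0 (c *\<^sub>R v))"
      using False by (simp add: field_simps)
    with le[of c v] show ?thesis by linarith
  qed
  have tri: "variation (extend0 (v + w)) \<le> variation (extend0 v) + variation (extend0 w)"
    for v w :: "real ^ 'm"
  proof -
    obtain p q where "variation (extend0 (v + w)) = extend0 (v + w) p - extend0 (v + w) q"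
      by (rule variation_attained)
    then show ?thesis
      using variation_ge[of "extend0 v" p q] variation_ge[of "extend0 w" p q]
      by (simp add: extend0_linear)
  qed
  show ?thesis
    unfolding is_norm_def using nonneg zero hom tri
    by (auto simp: field_simps)
qed

section \<open>The embedding\<close>

text \<open>The two ends of the chord account for the maximum and for the minimum, respectively, of the
  difference of the logarithmic facet coordinates.\<close>

lemma hilbert_dist_polytope:
  fixes P :: "'a::euclidean_space set" and g :: "'p::finite \<Rightarrow> 'a set"
  assumes P: "polytope P" "affine hull P = UNIV"
    and h: "\<And>F x y u. h F (y + u *\<^sub>R (x - y)) = h F y + u * (h F x - h F y)"
      "\<And>F x. F facet_of P \<Longrightarrow> x \<in> P \<Longrightarrow> 0 \<le> (h F x :: real)"
      "\<And>F x. F facet_of P \<Longrightarrow> x \<in> P \<Longrightarrow> h F x = 0 \<longleftrightarrow> x \<in> F"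
    and g: "range g = {F. F facet_of P}"
    and x: "x \<in> interior P" and y: "y \<in> interior P"
  shows "hilbert_dist (interior P) x y
    = 1/2 * variation (\<lambda>p. ln (h (g p) x) - ln (h (g p) y))"
proof (cases "x = y")
  case True
  have "variation (\<lambda>p::'p. 0) = 0"
    by (simp add: variation_def)
  with True show ?thesis by (simp add: hilbert_dist_def)
next
  case False
  have gf: "g p facet_of P" for p using g by blast
  have pos: "h (g p) z > 0" if "z \<in> interior P" for p z
    using h(2,3)[OF gf, of z p] interior_not_in_facet[OF gf that] that interior_subset
    by (metis less_le subsetD)
  obtain s where s: "s > 1" "y + s *\<^sub>R (x - y) \<in> frontier (interior P)"
    "\<And>F. F facet_of P \<Longrightarrow> h F y / h F x \<le> s / (s - 1)"
    "\<exists>F. F facet_of P \<and> h F y / h F x = s / (s - 1)"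
    using exit_parameter_facet_ratio[where h = h, OF P h x y False]
    by blast
  obtain t where t: "t > 1" "x + t *\<^sub>R (y - x) \<in> frontier (interior P)"
    "\<And>F. F facet_of P \<Longrightarrow> h F x / h F y \<le> t / (t - 1)"
    "\<exists>F. F facet_of P \<and> h F x / h F y = t / (t - 1)"
    using exit_parameter_facet_ratio[where h = h, OF P h y x False[symmetric]]
    by blast
  have cv: "convex (interior P)"
    using P(1) by (simp add: polytope_imp_convex convex_interior)
  have "hilbert_dist (interior P) x y = 1/2 * (ln (s / (s - 1)) + ln (t / (t - 1)))"
    using hilbert_dist_ray_parameters[OF cv open_interior x y False s(1,2) t(1,2)] .
  moreover have "variation (\<lambda>p. ln (h (g p) x) - ln (h (g p) y))
    = ln (t / (t - 1)) + ln (s / (s - 1))"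
  proof -
    have lnxy: "ln (h (g p) x) - ln (h (g p) y) = ln (h (g p) x / h (g p) y)"
      "- (ln (h (g p) x) - ln (h (g p) y)) = ln (h (g p) y / h (g p) x)" for p
      using pos[OF x, of p] pos[OF y, of p] by (simp_all add: ln_div)
    obtain p0 where p0: "h (g p0) x / h (g p0) y = t / (t - 1)"
      using t(4) g by (metis imageE mem_Collect_eq)
    obtain q0 where q0: "h (g q0) y / h (g q0) x = s / (s - 1)"
      using s(4) g by (metis imageE mem_Collect_eq)
    show ?thesis
    proof (rule variation_eqI)
      show "ln (h (g p) x) - ln (h (g p) y) \<le> ln (t / (t - 1))" for p
        unfolding lnxy using t(1) pos[OF x, of p] pos[OF y, of p] t(3)[OF gf, of p]
        by simp
      show "ln (h (g p0) x) - ln (h (g p0) y) = ln (t / (t - 1))"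
        unfolding lnxy p0 ..
      show "- (ln (h (g p) x) - ln (h (g p) y)) \<le> ln (s / (s - 1))" for p
        unfolding lnxy(2) using s(1) pos[OF x, of p] pos[OF y, of p] s(3)[OF gf, of p]
        by simp
      show "- (ln (h (g q0) x) - ln (h (g q0) y)) = ln (s / (s - 1))"
        unfolding lnxy(2) q0 ..
    qed
  qed
  ultimately show ?thesis by simp
qed

theorem mainTheorem1:
  fixes P :: "(real ^ 'n) set" and N :: nat
  assumes "full_polytope P"
    and "card (k_faces (CARD('n) - 1) P) = N + 1"
    and "CARD('m) = N"
  shows "\<exists>(\<nu> :: real ^ 'm \<Rightarrow> real) (f :: real ^ 'n \<Rightarrow> real ^ 'm).
    is_norm \<nu> \<and>
    (\<forall>x \<in> interior P. \<forall>y \<in> interior P. \<nu> (f x - f y) = hilbert_dist (interior P) x y)"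
proof -
  note P = full_polytope_affine_hull[OF assms(1)]
  have "card {F. F facet_of P} = card (UNIV :: 'm option set)"
    using card_facets_full_polytope[OF assms(1)] assms(2,3) by (simp add: card_UNIV_option)
  then obtain g :: "'m option \<Rightarrow> (real ^ 'n) set" where "bij_betw g UNIV {F. F facet_of P}"
    using finite_same_card_bij[of UNIV "{F. F facet_of P}"] finite_polytope_facets[OF P(1)]
    by (metis finite_code)
  then have g: "range g = {F. F facet_of P}"
    by (simp add: bij_betw_def)
  obtain h :: "(real ^ 'n) set \<Rightarrow> real ^ 'n \<Rightarrow> real" where h:
    "\<And>F x y u. h F (y + u *\<^sub>R (x - y)) = h F y + u * (h F x - h F y)"
    "\<And>F x. F facet_of P \<Longrightarrow> x \<in> P \<Longrightarrow> 0 \<le> h F x"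
    "\<And>F x. F facet_of P \<Longrightarrow> x \<in> P \<Longrightarrow> h F x = 0 \<longleftrightarrow> x \<in> F"
    using polyhedron_facet_functionals[OF polytope_imp_polyhedron[OF P(1)]] by metis
  define f :: "real ^ 'n \<Rightarrow> real ^ 'm"
    where "f x = (\<chi> i. ln (h (g (Some i)) x) - ln (h (g None) x))" for x
  have f: "extend0 (f x - f y)
    = (\<lambda>p. (ln (h (g p) x) - ln (h (g p) y)) - (ln (h (g None) x) - ln (h (g None) y)))" for x y
  proof
    show "extend0 (f x - f y) p
      = (ln (h (g p) x) - ln (h (g p) y)) - (ln (h (g None) x) - ln (h (g None) y))" for p
      by (cases p) (simp_all add: f_def)
  qed
  have "1/2 * variation (extend0 (f x - f y)) = hilbert_dist (interior P) x y"
    if "x \<in> interior P" "y \<in> interior P" for x y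
    unfolding f variation_shift
    using hilbert_dist_polytope[where h = h, OF P h g that] by simp
  then show ?thesis
    using is_norm_variation_extend0 by blast
qed

end
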